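(* Let $V$ be a finite-dimensional vector space over a field $K$ and let $f : V \to V$ be a $K$-linear map all of whose eigenvalues lie in $K$ (that is, the characteristic polynomial of $f$ splits over $K$). If $|K| > 2$, then each characteristic subspace of $V$ (with respect to $f$) is hyperinvariant (for $f$), i.e. $\mathrm{Chinv}(V) = \mathrm{Hinv}(V)$.
   Context: Let $\mathrm{End}_f(V)$ be the algebra of all $K$-linear endomorphisms of $V$ that commute with $f$ and $\mathrm{Aut}_f(V)$ the group of all $K$-linear automorphisms of $V$ that commute with $f$. A subspace $X \subseteq V$ is hyperinvariant (for $f$) if $g(X) \subseteq X$ for all $g \in \mathrm{End}_f(V)$. A subspace $X$ is characteristic (with respect to $f$) if $X$ is $f$-invariant and $\alpha(X) = X$ for all $\alpha \in \mathrm{Aut}_f(V)$. $\mathrm{Hinv}(V)$ and $\mathrm{Chinv}(V)$ denote the sets of hyperinvariant and characteristic subspaces of $V$, respectively. *)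

theory Defs
  imports Jordan_Normal_Form.Char_Poly
begin

definition End_comm ::
  "('k::field \<Rightarrow> 'v::ab_group_add \<Rightarrow> 'v) \<Rightarrow> ('v \<Rightarrow> 'v) \<Rightarrow> ('v \<Rightarrow> 'v) set" where
  "End_comm scale f = {g. Vector_Spaces.linear scale scale g \<and> g \<circ> f = f \<circ> g}"

definition Aut_comm ::
  "('k::field \<Rightarrow> 'v::ab_group_add \<Rightarrow> 'v) \<Rightarrow> ('v \<Rightarrow> 'v) \<Rightarrow> ('v \<Rightarrow> 'v) set" where
  "Aut_comm scale f = {g. Vector_Spaces.linear scale scale g \<and> bij g \<and> g \<circ> f = f \<circ> g}"

definition hyperinvariant ::
  "('k::field \<Rightarrow> 'v::ab_group_add \<Rightarrow> 'v) \<Rightarrow> ('v \<Rightarrow> 'v) \<Rightarrow> 'v set \<Rightarrow> bool" where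
  "hyperinvariant scale f X \<longleftrightarrow> Modules.module.subspace scale X \<and>
    (\<forall>g\<in>End_comm scale f. g ` X \<subseteq> X)"

definition characteristic ::
  "('k::field \<Rightarrow> 'v::ab_group_add \<Rightarrow> 'v) \<Rightarrow> ('v \<Rightarrow> 'v) \<Rightarrow> 'v set \<Rightarrow> bool" where
  "characteristic scale f X \<longleftrightarrow> Modules.module.subspace scale X \<and> f ` X \<subseteq> X \<and>
    (\<forall>g\<in>Aut_comm scale f. g ` X = X)"

definition Hinv ::
  "('k::field \<Rightarrow> 'v::ab_group_add \<Rightarrow> 'v) \<Rightarrow> ('v \<Rightarrow> 'v) \<Rightarrow> 'v set set" where
  "Hinv scale f = {X. hyperinvariant scale f X}"

definition Chinv ::
  "('k::field \<Rightarrow> 'v::ab_group_add \<Rightarrow> 'v) \<Rightarrow> ('v \<Rightarrow> 'v) \<Rightarrow> 'v set set" where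
  "Chinv scale f = {X. characteristic scale f X}"

definition ordered_basis ::
  "('k::field \<Rightarrow> 'v::ab_group_add \<Rightarrow> 'v) \<Rightarrow> 'v list \<Rightarrow> bool" where
  "ordered_basis scale bs \<longleftrightarrow> distinct bs \<and>
    \<not> Modules.module.dependent scale (set bs) \<and>
    Modules.module.span scale (set bs) = UNIV"

definition matrix_wrt ::
  "('k::field \<Rightarrow> 'v::ab_group_add \<Rightarrow> 'v) \<Rightarrow> 'v list \<Rightarrow> ('v \<Rightarrow> 'v) \<Rightarrow> 'k mat" where
  "matrix_wrt scale bs f = mat (length bs) (length bs)
     (\<lambda>(i, j). Modules.module.representation scale (set bs) (f (bs ! j)) (bs ! i))"

text \<open>The characteristic polynomial of a linear map of a finite-dimensional space is that of its
  matrix in any ordered basis: matrices in different bases are similar, so the choice made by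
  \<open>SOME\<close> is immaterial.  In infinite dimension no such list exists and the value is meaningless.\<close>

definition lin_char_poly ::
  "('k::field \<Rightarrow> 'v::ab_group_add \<Rightarrow> 'v) \<Rightarrow> ('v \<Rightarrow> 'v) \<Rightarrow> 'k poly" where
  "lin_char_poly scale f = char_poly (matrix_wrt scale (SOME bs. ordered_basis scale bs) f)"

definition poly_splits :: "'k::field poly \<Rightarrow> bool" where
  "poly_splits p \<longleftrightarrow> (\<exists>c as. p = Polynomial.smult c (\<Prod>a\<leftarrow>as. [:- a, 1:]))"

end

theory Submission
  imports Defs
begin

text \<open>The point is that every endomorphism \<open>g\<close> commuting with \<open>f\<close> is a sum of two
  automorphisms commuting with \<open>f\<close>; a subspace mapped into itself by all such automorphisms is
  then mapped into itself by \<open>g\<close>.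

  To split \<open>g\<close>, use the Fitting decomposition \<open>V = range (g ^^ n) \<oplus> ker (g ^^ n)\<close> for large \<open>n\<close>.
  On the first summand \<open>g\<close> is invertible, so for a scalar \<open>c\<close> other than \<open>0\<close> and \<open>1\<close> both terms of
  \<open>g = c g + (1 - c) g\<close> are invertible; such a scalar exists because the field has more than two
  elements.  On the second summand \<open>g\<close> is nilpotent, so both terms of \<open>g = 1 + (g - 1)\<close> are
  invertible.  The pieces glue to automorphisms of \<open>V\<close>, and these commute with \<open>f\<close> because the
  projection belonging to the decomposition is determined by \<open>g\<close> and hence commutes with every
  linear map that commutes with \<open>g\<close> (lemma \<open>fitting_projection\<close>).

  Conversely, the inverse of an automorphism commuting with \<open>f\<close> is again an endomorphism
  commuting with \<open>f\<close>, which makes every hyperinvariant subspace characteristic.\<close>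

section \<open>The Fitting projection of a linear map\<close>

lemma funpow_commute:
  assumes "\<And>x. h (g x) = g (h x)"
  shows "h ((g ^^ n) x) = (g ^^ n) (h x)"
  by (induction n) (simp_all add: assms)

lemma (in vector_space) linear_funpow:
  assumes "Vector_Spaces.linear scale scale g"
  shows "Vector_Spaces.linear scale scale (g ^^ n)"
proof (induction n)
  case 0
  show ?case using linear_id by (simp add: id_def)
next
  case (Suc n)
  show ?case using Vector_Spaces.linear_compose[OF Suc assms] by (simp add: o_def)
qed

context finite_dimensional_vector_space
begin

text \<open>The ranges of the powers of \<open>g\<close> shrink and their kernels grow, so in finite dimension both
  chains are eventually constant.  The stability from \<open>n\<close> to \<open>2 * n\<close> is what makes
  \<open>range (g ^^ n)\<close> and \<open>ker (g ^^ n)\<close> span \<open>V\<close> and meet trivially, respectively.\<close>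

lemma powers_stabilize:
  assumes g: "Vector_Spaces.linear scale scale g"
  obtains n where "n > 0"
    and "range (g ^^ n) \<subseteq> range (g ^^ (n + n))"
    and "\<And>x. (g ^^ (n + n)) x = 0 \<Longrightarrow> (g ^^ n) x = 0"
proof -
  interpret P: vector_space_pair scale scale by unfold_locales
  define R where "R m = range (g ^^ m)" for m
  define N where "N m = {x. (g ^^ m) x = 0}" for m
  have lin: "Vector_Spaces.linear scale scale (g ^^ m)" for m
    by (rule linear_funpow[OF g])
  have zero: "(g ^^ m) 0 = 0" for m
    by (rule P.linear_0[OF lin])
  have subR: "subspace (R m)" for m
    unfolding R_def by (rule P.linear_subspace_image[OF lin subspace_UNIV])
  have subN: "subspace (N m)" for m
    unfolding N_def by (rule P.linear_subspace_kernel[OF lin])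
  have R_mono: "R (m + k) \<subseteq> R m" for m k
    unfolding R_def by (auto simp: funpow_add)
  have N_mono: "N m \<subseteq> N (k + m)" for m k
    unfolding N_def by (auto simp: funpow_add zero)
  obtain p where p: "\<And>m. dim (R p) \<le> dim (R m)"
    using ex_has_least_nat[of "\<lambda>_. True" 0 "\<lambda>m. dim (R m)"] by auto
  obtain q where q: "\<And>m. dim (N m) \<le> dim (N q)"
    using ex_has_greatest_nat[of "\<lambda>_. True" 0 "\<lambda>m. dim (N m)" "dimension + 1"]
      dim_subset_UNIV by (auto simp: less_Suc_eq_le)
  \<comment> \<open>By monotonicity both extrema persist at every index beyond \<open>p\<close> and \<open>q\<close>; the summand \<open>1\<close>
    only makes \<open>n\<close> positive.\<close>
  define n where "n = p + q + 1"
  have "dim (R n) \<le> dim (R p)"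
    using R_mono[of p "q + 1"] dim_subset by (simp add: n_def add.assoc)
  then have "dim (R n) \<le> dim (R (n + n))"
    using p[of "n + n"] by simp
  then have "R (n + n) = R n"
    by (intro subspace_dim_equal subR R_mono)
  moreover have "dim (N q) \<le> dim (N n)"
    using N_mono[of q "p + 1"] dim_subset by (simp add: n_def algebra_simps)
  then have "dim (N (n + n)) \<le> dim (N n)"
    using q[of "n + n"] by simp
  then have "N n = N (n + n)"
    by (intro subspace_dim_equal subN N_mono)
  moreover have "n > 0"
    by (simp add: n_def)
  ultimately show ?thesis
    using that[of n] unfolding R_def N_def by blast
qed

text \<open>The map \<open>e\<close> is the projection onto \<open>range (g ^^ n)\<close> along \<open>ker (g ^^ n)\<close>.  A linear map
  commuting with \<open>g\<close> preserves both summands, which is why it commutes with \<open>e\<close>.  The last two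
  conclusions say that \<open>g\<close> is injective on the range of \<open>e\<close> and nilpotent on its kernel.\<close>

lemma fitting_projection:
  assumes g: "Vector_Spaces.linear scale scale g"
  obtains e n where "Vector_Spaces.linear scale scale e"
    and "\<And>x. e (e x) = e x"
    and "\<And>h x. Vector_Spaces.linear scale scale h \<Longrightarrow> (\<And>y. h (g y) = g (h y))
           \<Longrightarrow> e (h x) = h (e x)"
    and "\<And>x. g (e x) = 0 \<Longrightarrow> e x = 0"
    and "\<And>x. e x = 0 \<Longrightarrow> (g ^^ n) x = 0"
proof -
  interpret P: vector_space_pair scale scale by unfold_locales
  obtain n where n: "n > 0"
    and range_n: "range (g ^^ n) \<subseteq> range (g ^^ (n + n))"
    and ker_n: "\<And>x. (g ^^ (n + n)) x = 0 \<Longrightarrow> (g ^^ n) x = 0"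
    using powers_stabilize[OF g] by blast
  let ?G = "g ^^ n"
  have G: "Vector_Spaces.linear scale scale ?G"
    by (rule linear_funpow[OF g])
  note G_simps = P.linear_add[OF G] P.linear_diff[OF G] P.linear_scale[OF G] P.linear_0[OF G]
  have trivial_Int: "w = 0" if w: "w \<in> range ?G" "?G w = 0" for w
  proof -
    obtain u where u: "w = ?G u" using w(1) by blast
    then have "(g ^^ (n + n)) u = 0"
      using w(2) by (simp add: funpow_add)
    then show ?thesis
      using ker_n u by blast
  qed
  have unique: "w = w'" if "w \<in> range ?G" "w' \<in> range ?G" "?G (v - w) = 0" "?G (v - w') = 0"
    for v w w'
  proof -
    have "w - w' \<in> range ?G"
      using that(1,2) P.linear_subspace_image[OF G subspace_UNIV] subspace_diff by blast
    moreover have "?G (w - w') = 0"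
      using that(3,4) by (simp add: G_simps)
    ultimately show ?thesis
      using trivial_Int[of "w - w'"] by simp
  qed
  have "\<exists>w. w \<in> range ?G \<and> ?G (v - w) = 0" for v
  proof -
    obtain u where "?G v = ?G (?G u)"
      using range_n by (force simp: funpow_add)
    then show ?thesis
      by (intro exI[of _ "?G u"]) (simp add: G_simps)
  qed
  then obtain e where e_range: "\<And>v. e v \<in> range ?G" and e_ker: "\<And>v. ?G (v - e v) = 0"
    by metis
  have e_eqI: "e v = w" if "w \<in> range ?G" "?G (v - w) = 0" for v w
    using unique[OF e_range that(1) e_ker that(2)] .
  show ?thesis
  proof (rule that[of e n])
    have range_G: "subspace (range ?G)"
      by (rule P.linear_subspace_image[OF G subspace_UNIV])
    show "Vector_Spaces.linear scale scale e"
    proof (rule Vector_Spaces.linear_iff[THEN iffD2], intro conjI allI)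
      show "vector_space scale" by (rule vector_space_axioms)
      show "vector_space scale" by (rule vector_space_axioms)
      fix x y and c :: 'a
      show "e (x + y) = e x + e y"
        using e_ker[of x] e_ker[of y]
        by (intro e_eqI subspace_add[OF range_G] e_range) (simp add: G_simps algebra_simps)
      show "e (c *s x) = c *s e x"
        using e_ker[of x]
        by (intro e_eqI subspace_scale[OF range_G] e_range)
          (simp add: G_simps flip: scale_right_diff_distrib)
    qed
    show "e (e x) = e x" for x
      by (rule e_eqI[OF e_range]) (simp add: G_simps)
    show "e (h x) = h (e x)"
      if h: "Vector_Spaces.linear scale scale h" and comm: "\<And>y. h (g y) = g (h y)" for h x
    proof (rule e_eqI)
      have hG: "h (?G y) = ?G (h y)" for y
        by (rule funpow_commute) (rule comm)
      obtain u where "e x = ?G u" using e_range by blast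
      then show "h (e x) \<in> range ?G"
        by (simp add: hG)
      have "?G (h x - h (e x)) = h (?G (x - e x))"
        by (simp add: hG P.linear_diff[OF h])
      then show "?G (h x - h (e x)) = 0"
        by (simp add: e_ker P.linear_0[OF h])
    qed
    show "e x = 0" if "g (e x) = 0" for x
    proof (rule trivial_Int[OF e_range])
      obtain m where "n = Suc m" using n by (cases n) auto
      then show "?G (e x) = 0"
        using that P.linear_0[OF linear_funpow[OF g]] by (simp add: funpow_Suc_right del: funpow.simps)
    qed
    show "?G x = 0" if "e x = 0" for x
      using e_ker[of x] that by simp
  qed
qed

section \<open>Endomorphisms as sums of two automorphisms\<close>

text \<open>Injectivity alone suffices here because the dimension is finite.\<close>

lemma Aut_commI:
  assumes "Vector_Spaces.linear scale scale u" and "\<And>x. u x = 0 \<Longrightarrow> x = 0"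
    and "\<And>x. u (f x) = f (u x)"
  shows "u \<in> Aut_comm scale f"
proof -
  interpret P: vector_space_pair scale scale by unfold_locales
  have "inj u"
    using assms(1,2) P.linear_inj_iff_eq_0 by blast
  then have "bij u"
    using linear_inj_imp_surj[OF assms(1)] by (simp add: bij_def)
  with assms show ?thesis
    by (auto simp: Aut_comm_def)
qed

text \<open>With \<open>e\<close> the Fitting projection of \<open>g\<close>, the summands are
  \<open>c g e + (1 - e)\<close> and \<open>(1 - c) g e + (g - 1) (1 - e)\<close>.  If one of them kills \<open>x\<close>, applying \<open>e\<close>
  leaves a nonzero multiple of \<open>g (e x)\<close>, so \<open>e x = 0\<close>; then \<open>x\<close> is \<open>0\<close> at once for the first
  summand, and for the second \<open>x\<close> is a fixed point of \<open>g\<close> on which \<open>g\<close> acts nilpotently.\<close>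

lemma End_comm_sum_of_two_Aut_comm:
  fixes c :: 'a
  assumes f: "Vector_Spaces.linear scale scale f" and "g \<in> End_comm scale f"
    and c: "c \<noteq> 0" "c \<noteq> 1"
  obtains u w where "u \<in> Aut_comm scale f" and "w \<in> Aut_comm scale f"
    and "\<And>x. g x = u x + w x"
proof -
  interpret P: vector_space_pair scale scale by unfold_locales
  have g: "Vector_Spaces.linear scale scale g" and "g \<circ> f = f \<circ> g"
    using assms(2) by (auto simp: End_comm_def)
  then have gf: "g (f x) = f (g x)" for x
    by (metis comp_apply)
  obtain e n where e: "Vector_Spaces.linear scale scale e"
    and idem: "\<And>x. e (e x) = e x"
    and e_comm: "\<And>h x. Vector_Spaces.linear scale scale h \<Longrightarrow> (\<And>y. h (g y) = g (h y))
           \<Longrightarrow> e (h x) = h (e x)"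
    and inj: "\<And>x. g (e x) = 0 \<Longrightarrow> e x = 0"
    and nil: "\<And>x. e x = 0 \<Longrightarrow> (g ^^ n) x = 0"
    using fitting_projection[OF g] by blast
  have ef: "e (f x) = f (e x)" for x
    by (rule e_comm[OF f]) (simp add: gf)
  have eg: "e (g x) = g (e x)" for x
    by (rule e_comm[OF g]) simp
  note lin_simps =
    P.linear_add[OF g] P.linear_diff[OF g] P.linear_scale[OF g] P.linear_0[OF g]
    P.linear_add[OF e] P.linear_diff[OF e] P.linear_scale[OF e] P.linear_0[OF e]
    P.linear_add[OF f] P.linear_diff[OF f] P.linear_scale[OF f]
  define u where "u x = c *s g (e x) + (x - e x)" for x
  define w where "w x = (1 - c) *s g (e x) + (g (x - e x) - (x - e x))" for x
  have "u \<in> Aut_comm scale f"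
  proof (rule Aut_commI)
    show "Vector_Spaces.linear scale scale u"
      unfolding Vector_Spaces.linear_iff by (auto simp: u_def lin_simps algebra_simps vector_space_axioms)
    show "u (f x) = f (u x)" for x
      by (simp add: u_def ef gf lin_simps)
    show "x = 0" if "u x = 0" for x
    proof -
      have "e (u x) = c *s g (e x)"
        by (simp add: u_def lin_simps eg idem)
      with that c have "e x = 0"
        by (simp add: lin_simps inj)
      with that show ?thesis
        by (simp add: u_def lin_simps)
    qed
  qed
  moreover have "w \<in> Aut_comm scale f"
  proof (rule Aut_commI)
    show "Vector_Spaces.linear scale scale w"
      unfolding Vector_Spaces.linear_iff by (auto simp: w_def lin_simps algebra_simps vector_space_axioms)
    show "w (f x) = f (w x)" for x
      by (simp add: w_def ef gf lin_simps)
    show "x = 0" if "w x = 0" for x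
    proof -
      have "e (w x) = (1 - c) *s g (e x)"
        by (simp add: w_def lin_simps eg idem)
      with that c have ex: "e x = 0"
        by (simp add: lin_simps inj)
      with that have "g x = x"
        by (simp add: w_def lin_simps)
      then have "(g ^^ n) x = x"
        by (induction n) simp_all
      with nil[OF ex] show ?thesis by simp
    qed
  qed
  moreover have "g x = u x + w x" for x
    by (simp add: u_def w_def lin_simps algebra_simps)
  ultimately show ?thesis
    by (rule that)
qed

section \<open>Characteristic and hyperinvariant subspaces\<close>

lemma characteristic_imp_hyperinvariant:
  fixes c :: 'a
  assumes f: "Vector_Spaces.linear scale scale f"
    and c: "c \<noteq> 0" "c \<noteq> 1"
    and X: "characteristic scale f X"
  shows "hyperinvariant scale f X"
  unfolding hyperinvariant_def
proof (intro conjI ballI subsetI)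
  show sub: "subspace X"
    using X by (simp add: characteristic_def)
  fix g y
  assume g: "g \<in> End_comm scale f" and "y \<in> g ` X"
  then obtain x where x: "x \<in> X" "y = g x" by blast
  obtain u w where uw: "u \<in> Aut_comm scale f" "w \<in> Aut_comm scale f" "\<And>x. g x = u x + w x"
    using End_comm_sum_of_two_Aut_comm[OF f g c] by blast
  have "u ` X = X" and "w ` X = X"
    using X uw by (simp_all add: characteristic_def)
  then have "u x \<in> X" and "w x \<in> X"
    using x by blast+
  then show "y \<in> X"
    using subspace_add[OF sub] x uw(3) by simp
qed

lemma inv_in_End_comm:
  assumes "a \<in> Aut_comm scale f"
  shows "inv_into UNIV a \<in> End_comm scale f"
proof -
  have a: "Vector_Spaces.linear scale scale a" and bij: "bij a" and comm: "a \<circ> f = f \<circ> a"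
    using assms by (auto simp: Aut_comm_def)
  have "Vector_Spaces.linear scale scale (inv_into UNIV a)"
    by (rule inj_linear_imp_inv_linear[OF a bij_is_inj[OF bij]])
  moreover have "inv_into UNIV a (f x) = f (inv_into UNIV a x)" for x
    using comm bij by (metis bij_inv_eq_iff comp_apply)
  ultimately show ?thesis
    by (auto simp: End_comm_def)
qed

lemma hyperinvariant_imp_characteristic:
  assumes f: "Vector_Spaces.linear scale scale f"
    and X: "hyperinvariant scale f X"
  shows "characteristic scale f X"
  unfolding characteristic_def
proof (intro conjI ballI equalityI)
  have invariant: "g ` X \<subseteq> X" if "g \<in> End_comm scale f" for g
    using X that by (simp add: hyperinvariant_def)
  show "subspace X"
    using X by (simp add: hyperinvariant_def)
  show "f ` X \<subseteq> X"
    by (rule invariant) (simp add: End_comm_def f)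
  fix a assume a: "a \<in> Aut_comm scale f"
  then show "a ` X \<subseteq> X"
    by (intro invariant) (simp add: Aut_comm_def End_comm_def)
  have "surj a"
    using a by (simp add: Aut_comm_def bij_is_surj)
  moreover have "inv_into UNIV a ` X \<subseteq> X"
    by (rule invariant[OF inv_in_End_comm[OF a]])
  ultimately show "X \<subseteq> a ` X"
    by (metis image_f_inv_f image_mono)
qed

end

lemma ex_scalar_neq_0_1:
  assumes "infinite (UNIV :: 'k set) \<or> card (UNIV :: 'k set) > 2"
  obtains c :: "'k::zero_neq_one" where "c \<noteq> 0" and "c \<noteq> 1"
proof -
  have "\<not> (UNIV :: 'k set) \<subseteq> {0, 1}"
  proof
    assume sub: "(UNIV :: 'k set) \<subseteq> {0, 1}"
    have fin: "finite (UNIV :: 'k set)"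
      by (rule finite_subset[OF sub]) simp
    have "card (UNIV :: 'k set) \<le> card {0, 1 :: 'k}"
      by (rule card_mono[OF _ sub]) simp
    with fin show False
      using assms by simp
  qed
  then show ?thesis
    using that by blast
qed

theorem theorem3p4:
  fixes scale :: "'k::field \<Rightarrow> 'v::ab_group_add \<Rightarrow> 'v"
    and Basis :: "'v set"
    and f :: "'v \<Rightarrow> 'v"
  assumes "finite_dimensional_vector_space scale Basis"
    and "Vector_Spaces.linear scale scale f"
    and "poly_splits (lin_char_poly scale f)"
    and "infinite (UNIV :: 'k set) \<or> card (UNIV :: 'k set) > 2"
  shows "(\<forall>X. characteristic scale f X \<longrightarrow> hyperinvariant scale f X)
    \<and> Chinv scale f = Hinv scale f"
proof -
  interpret finite_dimensional_vector_space scale Basis by fact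
  obtain c :: 'k where c: "c \<noteq> 0" "c \<noteq> 1"
    using ex_scalar_neq_0_1[OF assms(4)] .
  have "characteristic scale f X \<longleftrightarrow> hyperinvariant scale f X" for X
    using characteristic_imp_hyperinvariant[OF assms(2) c]
      hyperinvariant_imp_characteristic[OF assms(2)] by blast
  then show ?thesis
    by (simp add: Chinv_def Hinv_def)
qed

end
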